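(* Let $\mathsf{C}$ and $\mathsf{D}$ be strict monoidal categories. Then there is an isomorphism of categories $$\mathbf{Lax}(\mathsf{C},\mathsf{D}) \cong \mathbf{Strict}(\mathsf{L}(\mathsf{C}),\mathsf{D}),$$ where $\mathsf{L}(\mathsf{C})$ is the strict monoidal category given by generators and relations described in the context.
   Context: Let $\mathsf{C}$ be a strict monoidal category with tensor product $\otimes$ and unit $\mathbb{1}$. **The category $\mathsf{L}(\mathsf{C})$.** It is the strict monoidal category presented as follows. Its monoid of objects is the free monoid on the set of symbols $\{\underline{x} \mid x\in \mathrm{Obj}\,\mathsf{C}\}$, i.e. finite lists of symbols $\underline{x}$, with tensor product given by concatenation and monoidal unit the empty list $\emptyset$. Its morphisms are generated, as a strict monoidal category (under composition and tensor product), by: a morphism $\underline{f}:\underline{x}\to\underline{y}$ for every $x,y\in\mathrm{Obj}\,\mathsf{C}$ and $f\in \mathrm{Hom}_{\mathsf{C}}(x,y)$; a morphism $\ell_{x,z}:\underline{x}\otimes\underline{z}\to\underline{x\otimes z}$ for all $x,z\in \mathrm{Obj}\,\mathsf{C}$; and a morphism $j:\emptyset\to\underline{\mathbb{1}}$. They are subject to the relations (for all objects and all suitable morphisms of $\mathsf{C}$): (0) $\underline{\mathrm{id}_x}=\mathrm{id}_{\underline{x}}$; (1) $\underline{g}\circ\underline{f}=\underline{g\circ f}$ for composable $f,g$; (2) $\ell_{y,y'}\circ(\underline{f}\otimes\underline{f'})=\underline{f\otimes f'}\circ\ell_{x,x'}$ for $f:x\to y$, $f':x'\to y'$; (3) $\ell_{x\otimes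 z,w}\circ(\ell_{x,z}\otimes\mathrm{id}_{\underline{w}})=\ell_{x,z\otimes w}\circ(\mathrm{id}_{\underline{x}}\otimes\ell_{z,w})$; (4) $\ell_{x,\mathbb{1}}\circ(\mathrm{id}_{\underline{x}}\otimes j)=\mathrm{id}_{\underline{x}}$; (5) $\ell_{\mathbb{1},x}\circ(j\otimes\mathrm{id}_{\underline{x}})=\mathrm{id}_{\underline{x}}$. **Lax monoidal functors.** A lax monoidal functor $\mathcal{F}:\mathsf{C}\to\mathsf{D}$ between strict monoidal categories is a functor together with morphisms $m_{X,Y}:\mathcal{F}(X)\otimes\mathcal{F}(Y)\to\mathcal{F}(X\otimes Y)$, natural in $X,Y\in\mathsf{C}$, and a morphism $u:\mathbb{1}_{\mathsf{D}}\to\mathcal{F}(\mathbb{1}_{\mathsf{C}})$ such that $m_{X\otimes Y,Z}\circ(m_{X,Y}\otimes\mathrm{id}_{\mathcal{F}(Z)})=m_{X,Y\otimes Z}\circ(\mathrm{id}_{\mathcal{F}(X)}\otimes m_{Y,Z})$, $m_{\mathbb{1},X}\circ(u\otimes\mathrm{id}_{\mathcal{F}(X)})=\mathrm{id}_{\mathcal{F}(X)}$ and $m_{X,\mathbb{1}}\circ(\mathrm{id}_{\mathcal{F}(X)}\otimes u)=\mathrm{id}_{\mathcal{F}(X)}$. It is strict if all $m_{X,Y}$ and $u$ are identities. **Functor categories.** For strict monoidal categories $\mathsf{C},\mathsf{D}$, $\mathbf{Lax}(\mathsf{C},\mathsf{D})$ is the category of lax monoidal functors from $\mathsf{C}$ to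 $\mathsf{D}$, and $\mathbf{Strict}(\mathsf{C},\mathsf{D})$ is the category of strict monoidal functors from $\mathsf{C}$ to $\mathsf{D}$. In both cases the morphisms are the monoidal transformations, i.e. natural transformations $\sigma:\mathcal{F}\Rightarrow\mathcal{G}$ satisfying $\sigma_{X\otimes Y}\circ m^{\mathcal{F}}_{X,Y}=m^{\mathcal{G}}_{X,Y}\circ(\sigma_X\otimes\sigma_Y)$ for all $X,Y$.
   Formalization: Monoidal transformations are also required to satisfy the unit condition σ_1∘u^F = u^G in both categories; with only the multiplication condition of the context the claim fails, e.g. for C terminal and D the matrices over F_2. *)

theory Defs
  imports Main "HOL-Library.FuncSet"
begin

section \<open>Categories and strict monoidal categories\<close>

text \<open>Composition is written in the usual order: \<open>g \<cdot> f\<close> is \<open>f\<close> followed by \<open>g\<close>.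
  The operations are only meaningful on the carriers \<open>Obj\<close> and \<open>Arr\<close>.\<close>

record ('o, 'a) cat =
  Obj :: "'o set"
  Arr :: "'a set"
  Dom :: "'a \<Rightarrow> 'o"
  Cod :: "'a \<Rightarrow> 'o"
  Ident :: "'o \<Rightarrow> 'a"
  Comp :: "'a \<Rightarrow> 'a \<Rightarrow> 'a"  (infixl "\<cdot>\<index>" 60)

definition Hom :: "('o, 'a, 'm) cat_scheme \<Rightarrow> 'o \<Rightarrow> 'o \<Rightarrow> 'a set" where
  "Hom C x y = {f \<in> Arr C. Dom C f = x \<and> Cod C f = y}"

locale category =
  fixes C :: "('o, 'a, 'm) cat_scheme" (structure)
  assumes Dom_Obj: "f \<in> Arr C \<Longrightarrow> Dom C f \<in> Obj C"
    and Cod_Obj: "f \<in> Arr C \<Longrightarrow> Cod C f \<in> Obj C"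
    and Ident_Hom: "x \<in> Obj C \<Longrightarrow> Ident C x \<in> Hom C x x"
    and Comp_Hom: "\<lbrakk>f \<in> Hom C x y; g \<in> Hom C y z\<rbrakk> \<Longrightarrow> g \<cdot> f \<in> Hom C x z"
    and Ident_left: "f \<in> Hom C x y \<Longrightarrow> Ident C y \<cdot> f = f"
    and Ident_right: "f \<in> Hom C x y \<Longrightarrow> f \<cdot> Ident C x = f"
    and Comp_assoc: "\<lbrakk>f \<in> Hom C x y; g \<in> Hom C y z; h \<in> Hom C z w\<rbrakk>
      \<Longrightarrow> (h \<cdot> g) \<cdot> f = h \<cdot> (g \<cdot> f)"

record ('o, 'a) moncat = "('o, 'a) cat" +
  Unit :: "'o"  ("\<one>\<index>")
  TensO :: "'o \<Rightarrow> 'o \<Rightarrow> 'o"  (infixl "\<otimes>\<index>" 70)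
  TensA :: "'a \<Rightarrow> 'a \<Rightarrow> 'a"  (infixl "\<odot>\<index>" 70)

locale strict_monoidal_category = category C
  for C :: "('o, 'a, 'm) moncat_scheme" (structure) +
  assumes Unit_Obj: "\<one> \<in> Obj C"
    and TensO_Obj: "\<lbrakk>x \<in> Obj C; y \<in> Obj C\<rbrakk> \<Longrightarrow> x \<otimes> y \<in> Obj C"
    and TensO_assoc: "\<lbrakk>x \<in> Obj C; y \<in> Obj C; z \<in> Obj C\<rbrakk> \<Longrightarrow> (x \<otimes> y) \<otimes> z = x \<otimes> (y \<otimes> z)"
    and TensO_Unit_left: "x \<in> Obj C \<Longrightarrow> \<one> \<otimes> x = x"
    and TensO_Unit_right: "x \<in> Obj C \<Longrightarrow> x \<otimes> \<one> = x"
    and TensA_Hom: "\<lbrakk>f \<in> Hom C x y; f' \<in> Hom C x' y'\<rbrakk> \<Longrightarrow> f \<odot> f' \<in> Hom C (x \<otimes> x') (y \<otimes> y')"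
    and TensA_Ident: "\<lbrakk>x \<in> Obj C; y \<in> Obj C\<rbrakk> \<Longrightarrow> Ident C x \<odot> Ident C y = Ident C (x \<otimes> y)"
    and TensA_Comp: "\<lbrakk>f \<in> Hom C x y; g \<in> Hom C y z; f' \<in> Hom C x' y'; g' \<in> Hom C y' z'\<rbrakk>
      \<Longrightarrow> (g \<cdot> f) \<odot> (g' \<cdot> f') = (g \<odot> g') \<cdot> (f \<odot> f')"
    and TensA_assoc: "\<lbrakk>f \<in> Arr C; g \<in> Arr C; h \<in> Arr C\<rbrakk> \<Longrightarrow> (f \<odot> g) \<odot> h = f \<odot> (g \<odot> h)"
    and TensA_Unit_left: "f \<in> Arr C \<Longrightarrow> Ident C \<one> \<odot> f = f"
    and TensA_Unit_right: "f \<in> Arr C \<Longrightarrow> f \<odot> Ident C \<one> = f"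

section \<open>Functors and isomorphisms of categories\<close>

locale cat_functor = A: category A + B: category B
  for A :: "('o, 'a, 'm) cat_scheme" and B :: "('p, 'b, 'n) cat_scheme" +
  fixes FO :: "'o \<Rightarrow> 'p" and FA :: "'a \<Rightarrow> 'b"
  assumes FO_Obj: "x \<in> Obj A \<Longrightarrow> FO x \<in> Obj B"
    and FA_Hom: "f \<in> Hom A x y \<Longrightarrow> FA f \<in> Hom B (FO x) (FO y)"
    and FA_Ident: "x \<in> Obj A \<Longrightarrow> FA (Ident A x) = Ident B (FO x)"
    and FA_Comp: "\<lbrakk>f \<in> Hom A x y; g \<in> Hom A y z\<rbrakk> \<Longrightarrow> FA (g \<cdot>\<^bsub>A\<^esub> f) = FA g \<cdot>\<^bsub>B\<^esub> FA f"

definition isomorphic_cats :: "('o, 'a, 'm) cat_scheme \<Rightarrow> ('p, 'b, 'n) cat_scheme \<Rightarrow> bool" where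
  "isomorphic_cats A B \<longleftrightarrow> (\<exists>FO FA GO GA.
     cat_functor A B FO FA \<and> cat_functor B A GO GA \<and>
     (\<forall>x \<in> Obj A. GO (FO x) = x) \<and> (\<forall>f \<in> Arr A. GA (FA f) = f) \<and>
     (\<forall>y \<in> Obj B. FO (GO y) = y) \<and> (\<forall>g \<in> Arr B. FA (GA g) = g))"

section \<open>Lax and strict monoidal functors, monoidal transformations\<close>

record ('o, 'a, 'p, 'b) laxfun =
  onO :: "'o \<Rightarrow> 'p"
  onA :: "'a \<Rightarrow> 'b"
  mult :: "'o \<Rightarrow> 'o \<Rightarrow> 'b"
  unit :: "'b"

text \<open>The three \<open>_undefined\<close> conditions fix all maps outside the carriers, so that equality of
  the records is equality of lax monoidal functors.\<close>

locale lax_monoidal_functor =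
  C: strict_monoidal_category C + D: strict_monoidal_category D + cat_functor C D "onO F" "onA F"
  for C :: "('o, 'a, 'm) moncat_scheme" and D :: "('p, 'b, 'n) moncat_scheme"
    and F :: "('o, 'a, 'p, 'b) laxfun" +
  assumes mult_Hom: "\<lbrakk>x \<in> Obj C; y \<in> Obj C\<rbrakk>
      \<Longrightarrow> mult F x y \<in> Hom D (onO F x \<otimes>\<^bsub>D\<^esub> onO F y) (onO F (x \<otimes>\<^bsub>C\<^esub> y))"
    and mult_natural: "\<lbrakk>f \<in> Hom C x y; f' \<in> Hom C x' y'\<rbrakk>
      \<Longrightarrow> mult F y y' \<cdot>\<^bsub>D\<^esub> (onA F f \<odot>\<^bsub>D\<^esub> onA F f') = onA F (f \<odot>\<^bsub>C\<^esub> f') \<cdot>\<^bsub>D\<^esub> mult F x x'"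
    and unit_Hom: "unit F \<in> Hom D \<one>\<^bsub>D\<^esub> (onO F \<one>\<^bsub>C\<^esub>)"
    and mult_assoc: "\<lbrakk>x \<in> Obj C; y \<in> Obj C; z \<in> Obj C\<rbrakk>
      \<Longrightarrow> mult F (x \<otimes>\<^bsub>C\<^esub> y) z \<cdot>\<^bsub>D\<^esub> (mult F x y \<odot>\<^bsub>D\<^esub> Ident D (onO F z))
        = mult F x (y \<otimes>\<^bsub>C\<^esub> z) \<cdot>\<^bsub>D\<^esub> (Ident D (onO F x) \<odot>\<^bsub>D\<^esub> mult F y z)"
    and mult_unit_left: "x \<in> Obj C
      \<Longrightarrow> mult F \<one>\<^bsub>C\<^esub> x \<cdot>\<^bsub>D\<^esub> (unit F \<odot>\<^bsub>D\<^esub> Ident D (onO F x)) = Ident D (onO F x)"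
    and mult_unit_right: "x \<in> Obj C
      \<Longrightarrow> mult F x \<one>\<^bsub>C\<^esub> \<cdot>\<^bsub>D\<^esub> (Ident D (onO F x) \<odot>\<^bsub>D\<^esub> unit F) = Ident D (onO F x)"
    and onO_undefined: "onO F \<in> extensional (Obj C)"
    and onA_undefined: "onA F \<in> extensional (Arr C)"
    and mult_undefined: "x \<notin> Obj C \<or> y \<notin> Obj C \<Longrightarrow> mult F x y = undefined"

text \<open>That \<open>mult\<close> and \<open>unit\<close> consist of identities entails, by their typing, that
  \<open>onO F (x \<otimes> y) = onO F x \<otimes> onO F y\<close> and \<open>onO F \<one> = \<one>\<close>.\<close>

locale strict_monoidal_functor = lax_monoidal_functor C D F
  for C :: "('o, 'a, 'm) moncat_scheme" and D :: "('p, 'b, 'n) moncat_scheme"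
    and F :: "('o, 'a, 'p, 'b) laxfun" +
  assumes mult_Ident: "\<lbrakk>x \<in> Obj C; y \<in> Obj C\<rbrakk> \<Longrightarrow> mult F x y = Ident D (onO F x \<otimes>\<^bsub>D\<^esub> onO F y)"
    and unit_Ident: "unit F = Ident D \<one>\<^bsub>D\<^esub>"

record ('o, 'a, 'p, 'b) montrans =
  Src :: "('o, 'a, 'p, 'b) laxfun"
  Tgt :: "('o, 'a, 'p, 'b) laxfun"
  cmp :: "'o \<Rightarrow> 'b"

text \<open>As usual, a monoidal transformation is compatible with both structure maps of a lax
  monoidal functor, the multiplications (\<open>cmp_mult\<close>) and the units (\<open>cmp_unit\<close>). The latter
  does not follow from the former: for the terminal category as source, lax monoidal functors
  are monoids in the target, and \<open>cmp_unit\<close> separates the unital from the non-unital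
  homomorphisms.\<close>

locale monoidal_transformation =
  Src: lax_monoidal_functor C D "Src \<sigma>" + Tgt: lax_monoidal_functor C D "Tgt \<sigma>"
  for C :: "('o, 'a, 'm) moncat_scheme" and D :: "('p, 'b, 'n) moncat_scheme"
    and \<sigma> :: "('o, 'a, 'p, 'b) montrans" +
  assumes cmp_Hom: "x \<in> Obj C \<Longrightarrow> cmp \<sigma> x \<in> Hom D (onO (Src \<sigma>) x) (onO (Tgt \<sigma>) x)"
    and cmp_natural: "f \<in> Hom C x y
      \<Longrightarrow> cmp \<sigma> y \<cdot>\<^bsub>D\<^esub> onA (Src \<sigma>) f = onA (Tgt \<sigma>) f \<cdot>\<^bsub>D\<^esub> cmp \<sigma> x"
    and cmp_mult: "\<lbrakk>x \<in> Obj C; y \<in> Obj C\<rbrakk>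
      \<Longrightarrow> cmp \<sigma> (x \<otimes>\<^bsub>C\<^esub> y) \<cdot>\<^bsub>D\<^esub> mult (Src \<sigma>) x y
        = mult (Tgt \<sigma>) x y \<cdot>\<^bsub>D\<^esub> (cmp \<sigma> x \<odot>\<^bsub>D\<^esub> cmp \<sigma> y)"
    and cmp_unit: "cmp \<sigma> \<one>\<^bsub>C\<^esub> \<cdot>\<^bsub>D\<^esub> unit (Src \<sigma>) = unit (Tgt \<sigma>)"
    and cmp_undefined: "cmp \<sigma> \<in> extensional (Obj C)"

definition Lax :: "('o, 'a, 'm) moncat_scheme \<Rightarrow> ('p, 'b, 'n) moncat_scheme
    \<Rightarrow> (('o, 'a, 'p, 'b) laxfun, ('o, 'a, 'p, 'b) montrans) cat" where
  "Lax C D = \<lparr>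
     Obj = {F. lax_monoidal_functor C D F},
     Arr = {\<sigma>. monoidal_transformation C D \<sigma>},
     Dom = Src,
     Cod = Tgt,
     Ident = (\<lambda>F. \<lparr>Src = F, Tgt = F, cmp = (\<lambda>x \<in> Obj C. Ident D (onO F x))\<rparr>),
     Comp = (\<lambda>\<tau> \<sigma>. \<lparr>Src = Src \<sigma>, Tgt = Tgt \<tau>, cmp = (\<lambda>x \<in> Obj C. cmp \<tau> x \<cdot>\<^bsub>D\<^esub> cmp \<sigma> x)\<rparr>)\<rparr>"

definition Strict :: "('o, 'a, 'm) moncat_scheme \<Rightarrow> ('p, 'b, 'n) moncat_scheme
    \<Rightarrow> (('o, 'a, 'p, 'b) laxfun, ('o, 'a, 'p, 'b) montrans) cat" where
  "Strict C D = (Lax C D)\<lparr>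
     Obj := {F. strict_monoidal_functor C D F},
     Arr := {\<sigma>. monoidal_transformation C D \<sigma> \<and>
       strict_monoidal_functor C D (Src \<sigma>) \<and> strict_monoidal_functor C D (Tgt \<sigma>)}\<rparr>"

section \<open>The strict monoidal category \<open>L(C)\<close> by generators and relations\<close>

text \<open>The object \<open>x\<^sub>1 \<otimes> \<dots> \<otimes> x\<^sub>n\<close> of symbols is the list \<open>[x\<^sub>1, \<dots>, x\<^sub>n]\<close> of objects of \<open>C\<close>.
  Morphisms are formal expressions in the generators \<open>Gen f\<close> (underlined \<open>f\<close>), \<open>Ell x z\<close>
  and \<open>Jay\<close>, modulo the congruence \<open>lrel\<close> generated by the axioms of a strict monoidal category
  and the defining relations.\<close>

datatype ('o, 'a) lterm =
    Gen 'a
  | Ell 'o 'o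
  | Jay
  | LId "'o list"
  | LComp "('o, 'a) lterm" "('o, 'a) lterm"
  | LTens "('o, 'a) lterm" "('o, 'a) lterm"

primrec ldom :: "('o, 'a, 'm) moncat_scheme \<Rightarrow> ('o, 'a) lterm \<Rightarrow> 'o list" where
  "ldom C (Gen f) = [Dom C f]"
| "ldom C (Ell x z) = [x, z]"
| "ldom C Jay = []"
| "ldom C (LId xs) = xs"
| "ldom C (LComp t s) = ldom C s"
| "ldom C (LTens t s) = ldom C t @ ldom C s"

primrec lcod :: "('o, 'a, 'm) moncat_scheme \<Rightarrow> ('o, 'a) lterm \<Rightarrow> 'o list" where
  "lcod C (Gen f) = [Cod C f]"
| "lcod C (Ell x z) = [x \<otimes>\<^bsub>C\<^esub> z]"
| "lcod C Jay = [\<one>\<^bsub>C\<^esub>]"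
| "lcod C (LId xs) = xs"
| "lcod C (LComp t s) = lcod C t"
| "lcod C (LTens t s) = lcod C t @ lcod C s"

primrec lwf :: "('o, 'a, 'm) moncat_scheme \<Rightarrow> ('o, 'a) lterm \<Rightarrow> bool" where
  "lwf C (Gen f) \<longleftrightarrow> f \<in> Arr C"
| "lwf C (Ell x z) \<longleftrightarrow> x \<in> Obj C \<and> z \<in> Obj C"
| "lwf C Jay \<longleftrightarrow> True"
| "lwf C (LId xs) \<longleftrightarrow> xs \<in> lists (Obj C)"
| "lwf C (LComp t s) \<longleftrightarrow> lwf C t \<and> lwf C s \<and> ldom C t = lcod C s"
| "lwf C (LTens t s) \<longleftrightarrow> lwf C t \<and> lwf C s"

inductive lrel :: "('o, 'a, 'm) moncat_scheme \<Rightarrow> ('o, 'a) lterm \<Rightarrow> ('o, 'a) lterm \<Rightarrow> bool"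
  for C :: "('o, 'a, 'm) moncat_scheme" (structure) where
  \<comment> \<open>congruence\<close>
  refl: "lwf C t \<Longrightarrow> lrel C t t"
| sym: "lrel C t t' \<Longrightarrow> lrel C t' t"
| trans: "\<lbrakk>lrel C t t'; lrel C t' t''\<rbrakk> \<Longrightarrow> lrel C t t''"
| Comp_cong: "\<lbrakk>lrel C t t'; lrel C s s'; ldom C t = lcod C s\<rbrakk>
    \<Longrightarrow> lrel C (LComp t s) (LComp t' s')"
| Tens_cong: "\<lbrakk>lrel C t t'; lrel C s s'\<rbrakk> \<Longrightarrow> lrel C (LTens t s) (LTens t' s')"
  \<comment> \<open>axioms of a strict monoidal category\<close>
| Id_left: "lwf C t \<Longrightarrow> lrel C (LComp (LId (lcod C t)) t) t"
| Id_right: "lwf C t \<Longrightarrow> lrel C (LComp t (LId (ldom C t))) t"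
| Comp_assoc: "lwf C (LComp (LComp t s) r)
    \<Longrightarrow> lrel C (LComp (LComp t s) r) (LComp t (LComp s r))"
| Tens_Id: "\<lbrakk>xs \<in> lists (Obj C); ys \<in> lists (Obj C)\<rbrakk>
    \<Longrightarrow> lrel C (LTens (LId xs) (LId ys)) (LId (xs @ ys))"
| Tens_Comp: "\<lbrakk>lwf C (LComp t s); lwf C (LComp t' s')\<rbrakk>
    \<Longrightarrow> lrel C (LTens (LComp t s) (LComp t' s')) (LComp (LTens t t') (LTens s s'))"
| Tens_assoc: "\<lbrakk>lwf C t; lwf C s; lwf C r\<rbrakk>
    \<Longrightarrow> lrel C (LTens (LTens t s) r) (LTens t (LTens s r))"
| Tens_Unit_left: "lwf C t \<Longrightarrow> lrel C (LTens (LId []) t) t"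
| Tens_Unit_right: "lwf C t \<Longrightarrow> lrel C (LTens t (LId [])) t"
  \<comment> \<open>defining relations\<close>
| Gen_Ident: "x \<in> Obj C \<Longrightarrow> lrel C (Gen (Ident C x)) (LId [x])"
| Gen_Comp: "\<lbrakk>f \<in> Hom C x y; g \<in> Hom C y z\<rbrakk> \<Longrightarrow> lrel C (LComp (Gen g) (Gen f)) (Gen (g \<cdot> f))"
| Ell_natural: "\<lbrakk>f \<in> Hom C x y; f' \<in> Hom C x' y'\<rbrakk>
    \<Longrightarrow> lrel C (LComp (Ell y y') (LTens (Gen f) (Gen f'))) (LComp (Gen (f \<odot> f')) (Ell x x'))"
| Ell_assoc: "\<lbrakk>x \<in> Obj C; z \<in> Obj C; w \<in> Obj C\<rbrakk>
    \<Longrightarrow> lrel C (LComp (Ell (x \<otimes> z) w) (LTens (Ell x z) (LId [w])))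
               (LComp (Ell x (z \<otimes> w)) (LTens (LId [x]) (Ell z w)))"
| Ell_Unit_right: "x \<in> Obj C \<Longrightarrow> lrel C (LComp (Ell x \<one>) (LTens (LId [x]) Jay)) (LId [x])"
| Ell_Unit_left: "x \<in> Obj C \<Longrightarrow> lrel C (LComp (Ell \<one> x) (LTens Jay (LId [x]))) (LId [x])"

definition lclass :: "('o, 'a, 'm) moncat_scheme \<Rightarrow> ('o, 'a) lterm \<Rightarrow> ('o, 'a) lterm set" where
  "lclass C t = {s. lrel C t s}"

text \<open>The operations on classes are given by operations on chosen representatives; by
  \<open>lrel_typing\<close> and the congruence rules they do not depend on the choice.\<close>

definition LCat :: "('o, 'a, 'm) moncat_scheme \<Rightarrow> ('o list, ('o, 'a) lterm set) moncat" where
  "LCat C = \<lparr>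
     Obj = lists (Obj C),
     Arr = lclass C ` {t. lwf C t},
     Dom = (\<lambda>T. ldom C (SOME t. t \<in> T)),
     Cod = (\<lambda>T. lcod C (SOME t. t \<in> T)),
     Ident = (\<lambda>xs. lclass C (LId xs)),
     Comp = (\<lambda>T S. lclass C (LComp (SOME t. t \<in> T) (SOME s. s \<in> S))),
     Unit = [],
     TensO = (@),
     TensA = (\<lambda>T S. lclass C (LTens (SOME t. t \<in> T) (SOME s. s \<in> S)))\<rparr>"

lemma lrel_typing:
  assumes "strict_monoidal_category C" and "lrel C t s"
  shows "lwf C t \<and> lwf C s \<and> ldom C t = ldom C s \<and> lcod C t = lcod C s"
proof -
  interpret strict_monoidal_category C by fact
  have H: "\<And>f x y. f \<in> Hom C x y \<Longrightarrow>
      f \<in> Arr C \<and> Dom C f = x \<and> Cod C f = y \<and> x \<in> Obj C \<and> y \<in> Obj C"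
    using Dom_Obj Cod_Obj by (auto simp: Hom_def)
  have wf: "ldom C t \<in> lists (Obj C) \<and> lcod C t \<in> lists (Obj C)" if "lwf C t" for t
    using that by (induction t) (auto simp: Dom_Obj Cod_Obj TensO_Obj Unit_Obj)
  show ?thesis
    using assms(2)
  proof (induction rule: lrel.induct)
    case (Gen_Ident x)
    then show ?case using H[OF Ident_Hom] by simp
  next
    case (Gen_Comp f x y g z)
    then show ?case using H[OF Gen_Comp(1)] H[OF Gen_Comp(2)] H[OF Comp_Hom[OF Gen_Comp]] by simp
  next
    case (Ell_natural f x y f' x' y')
    then show ?case
      using H[OF Ell_natural(1)] H[OF Ell_natural(2)] H[OF TensA_Hom[OF Ell_natural]] by simp
  qed (use wf in \<open>auto simp: TensO_Obj Unit_Obj TensO_assoc TensO_Unit_left TensO_Unit_right\<close>)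
qed

end

theory Submission
  imports Defs
begin

text \<open>The symbols \<open>x \<mapsto> [x]\<close> with the generators \<open>Gen\<close>, \<open>Ell\<close> and \<open>Jay\<close> form the universal lax
  monoidal functor on \<open>C\<close>: the defining relations of \<open>L(C)\<close> are exactly the axioms of a lax
  monoidal functor. Hence a strict monoidal functor on \<open>L(C)\<close> restricts along the generators to a
  lax monoidal functor on \<open>C\<close>, and conversely evaluating formal expressions in \<open>D\<close> extends a lax
  monoidal functor. A monoidal transformation \<open>\<sigma>\<close> extends by
  \<open>\<sigma>[x\<^sub>1, \<dots>, x\<^sub>n] = \<sigma> x\<^sub>1 \<odot> \<dots> \<odot> \<sigma> x\<^sub>n\<close>, which is forced by compatibility with the identity
  multiplications and unit; its naturality on \<open>Gen\<close>, \<open>Ell\<close> and \<open>Jay\<close> is naturality,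
  \<open>cmp_mult\<close> and \<open>cmp_unit\<close> of \<open>\<sigma>\<close>, and passes to all expressions by induction.\<close>

section \<open>Composition and typing in a category\<close>

context category
begin

lemma Hom_iff: "f \<in> Hom C x y \<longleftrightarrow> f \<in> Arr C \<and> Dom C f = x \<and> Cod C f = y"
  by (simp add: Hom_def)

lemma Dom_Cod_Obj [simp]:
  assumes "f \<in> Arr C" shows "Dom C f \<in> Obj C" "Cod C f \<in> Obj C"
  using assms Dom_Obj Cod_Obj by auto

lemma Ident_typing [simp]:
  assumes "x \<in> Obj C"
  shows "Ident C x \<in> Arr C" "Dom C (Ident C x) = x" "Cod C (Ident C x) = x"
  using Ident_Hom[OF assms] by (auto simp: Hom_def)

lemma Comp_typing [simp]:
  assumes "f \<in> Arr C" "g \<in> Arr C" "Dom C g = Cod C f"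
  shows "g \<cdot> f \<in> Arr C" "Dom C (g \<cdot> f) = Dom C f" "Cod C (g \<cdot> f) = Cod C g"
  using Comp_Hom[of f "Dom C f" "Cod C f" g "Cod C g"] assms by (auto simp: Hom_def)

lemma Comp_Ident [simp]:
  assumes "f \<in> Arr C"
  shows "x = Cod C f \<Longrightarrow> Ident C x \<cdot> f = f" "x = Dom C f \<Longrightarrow> f \<cdot> Ident C x = f"
  using assms by (auto intro: Ident_left Ident_right simp: Hom_def)

text \<open>The locale axiom mentions objects that cannot be read off from the composite. With
  \<open>Dom\<close> and \<open>Cod\<close> equations as premises the law can serve as a rewrite
  rule, its side conditions following from the typing rules; the other \<open>_Arr\<close> lemmas
  have this form for the same reason.\<close>

lemma Comp_assoc_Arr:
  assumes "f \<in> Arr C" "g \<in> Arr C" "h \<in> Arr C" "Dom C g = Cod C f" "Dom C h = Cod C g"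
  shows "(h \<cdot> g) \<cdot> f = h \<cdot> (g \<cdot> f)"
  using assms by (intro Comp_assoc) (auto simp: Hom_def)

text \<open>Serves to obtain \<open>Strict\<close> as a category from \<open>Lax\<close>.\<close>

lemma full_subcategory:
  assumes "P \<subseteq> Obj C"
  shows "category (C\<lparr>Obj := P, Arr := {f \<in> Arr C. Dom C f \<in> P \<and> Cod C f \<in> P}\<rparr>)"
  using assms by unfold_locales (auto simp: Hom_def Comp_assoc_Arr)

end

lemma (in cat_functor) FA_typing [simp]:
  assumes "f \<in> Arr A"
  shows "FA f \<in> Arr B" "Dom B (FA f) = FO (Dom A f)" "Cod B (FA f) = FO (Cod A f)"
  using FA_Hom[of f "Dom A f" "Cod A f"] assms by (auto simp: Hom_def)

lemma (in cat_functor) FA_Comp_Arr: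
  assumes "f \<in> Arr A" "g \<in> Arr A" "Dom A g = Cod A f"
  shows "FA (g \<cdot>\<^bsub>A\<^esub> f) = FA g \<cdot>\<^bsub>B\<^esub> FA f"
  using assms by (intro FA_Comp) (auto simp: Hom_def)

section \<open>Iterated tensor products of objects and of morphisms\<close>

definition tensOs :: "('o, 'a, 'm) moncat_scheme \<Rightarrow> 'o list \<Rightarrow> 'o" where
  "tensOs C xs = foldr (TensO C) xs (Unit C)"

text \<open>As in \<open>tensOs\<close>, the product is bracketed to the right and ends in the unit.
  A one-element list therefore leaves a trailing unit factor, removed by the strict unit laws
  declared as simp rules below.\<close>

definition tensAs :: "('o, 'a, 'm) moncat_scheme \<Rightarrow> 'a list \<Rightarrow> 'a" where
  "tensAs C fs = foldr (TensA C) fs (Ident C (Unit C))"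

lemma tensOs_simps [simp]:
  "tensOs C [] = Unit C" "tensOs C (x # xs) = TensO C x (tensOs C xs)"
  by (simp_all add: tensOs_def)

lemma tensAs_simps [simp]:
  "tensAs C [] = Ident C (Unit C)" "tensAs C (f # fs) = TensA C f (tensAs C fs)"
  by (simp_all add: tensAs_def)

context strict_monoidal_category
begin

declare Unit_Obj [simp] TensO_Obj [simp] TensO_Unit_left [simp] TensO_Unit_right [simp]
  TensA_Unit_left [simp] TensA_Unit_right [simp]

lemma TensA_typing [simp]:
  assumes "f \<in> Arr C" "g \<in> Arr C"
  shows "f \<odot> g \<in> Arr C" "Dom C (f \<odot> g) = Dom C f \<otimes> Dom C g" "Cod C (f \<odot> g) = Cod C f \<otimes> Cod C g"
  using TensA_Hom[of f "Dom C f" "Cod C f" g "Dom C g" "Cod C g"] assms by (auto simp: Hom_def)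

lemma TensA_Comp_Arr:
  assumes "f \<in> Arr C" "g \<in> Arr C" "Dom C g = Cod C f"
    and "f' \<in> Arr C" "g' \<in> Arr C" "Dom C g' = Cod C f'"
  shows "(g \<cdot> f) \<odot> (g' \<cdot> f') = (g \<odot> g') \<cdot> (f \<odot> f')"
  using assms by (intro TensA_Comp) (auto simp: Hom_def)

lemma tensOs_Obj [simp]: "set xs \<subseteq> Obj C \<Longrightarrow> tensOs C xs \<in> Obj C"
  by (induction xs) auto

lemma tensOs_append:
  "set xs \<subseteq> Obj C \<Longrightarrow> set ys \<subseteq> Obj C \<Longrightarrow> tensOs C (xs @ ys) = tensOs C xs \<otimes> tensOs C ys"
  by (induction xs) (auto simp: TensO_assoc)

lemma tensAs_typing [simp]:
  assumes "set fs \<subseteq> Arr C"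
  shows "tensAs C fs \<in> Arr C" "Dom C (tensAs C fs) = tensOs C (map (Dom C) fs)"
    "Cod C (tensAs C fs) = tensOs C (map (Cod C) fs)"
  using assms by (induction fs) auto

lemma tensAs_append:
  "set fs \<subseteq> Arr C \<Longrightarrow> set gs \<subseteq> Arr C \<Longrightarrow> tensAs C (fs @ gs) = tensAs C fs \<odot> tensAs C gs"
  by (induction fs) (auto simp: TensA_assoc)

lemma tensAs_Ident:
  "set xs \<subseteq> Obj C \<Longrightarrow> tensAs C (map (Ident C) xs) = Ident C (tensOs C xs)"
  by (induction xs) (auto simp: TensA_Ident)

text \<open>The interchange law, iterated along the list.\<close>

lemma tensAs_Comp:
  assumes "\<And>x. x \<in> set xs \<Longrightarrow> f x \<in> Arr C \<and> g x \<in> Arr C \<and> Dom C (g x) = Cod C (f x)"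
  shows "tensAs C (map (\<lambda>x. g x \<cdot> f x) xs) = tensAs C (map g xs) \<cdot> tensAs C (map f xs)"
  using assms
proof (induction xs)
  case (Cons x xs)
  then have "set (map f xs) \<subseteq> Arr C" "set (map g xs) \<subseteq> Arr C"
    "map (Dom C) (map g xs) = map (Cod C) (map f xs)"
    by auto
  \<comment> \<open>The nested maps must stay unmerged, so that the third fact above matches the
    lists produced by \<open>tensAs_typing\<close>.\<close>
  then show ?case using Cons by (simp add: TensA_Comp_Arr del: map_map)
qed simp

end

section \<open>The strict monoidal category \<open>L(C)\<close>\<close>

lemma LCat_simps [simp]:
  "Obj (LCat C) = lists (Obj C)" "Arr (LCat C) = lclass C ` {t. lwf C t}"
  "Ident (LCat C) xs = lclass C (LId xs)" "Unit (LCat C) = []" "TensO (LCat C) = (@)"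
  by (simp_all add: LCat_def)

context strict_monoidal_category
begin

lemmas lrel_typing' = lrel_typing[OF strict_monoidal_category_axioms]

lemma ldom_lcod_Obj:
  assumes "lwf C t"
  shows "ldom C t \<in> lists (Obj C)" "lcod C t \<in> lists (Obj C)"
  using assms by (induction t) auto

lemma lclass_eqI: "lrel C t s \<Longrightarrow> lclass C t = lclass C s"
  by (auto simp: lclass_def intro: lrel.sym lrel.trans)

text \<open>By reflexivity the class of \<open>t\<close> is not empty, so the choice made in
  \<open>LCat\<close> returns a term related to \<open>t\<close>. Together with the congruence rules
  this makes all operations on classes computable on arbitrary representatives.\<close>

lemma lrel_representative: "lwf C t \<Longrightarrow> lrel C t (SOME s. s \<in> lclass C t)"
  using someI[of "\<lambda>s. s \<in> lclass C t" t] by (simp add: lclass_def lrel.refl)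

lemma LCat_Dom_Cod [simp]:
  assumes "lwf C t"
  shows "Dom (LCat C) (lclass C t) = ldom C t" "Cod (LCat C) (lclass C t) = lcod C t"
  using lrel_typing'[OF lrel_representative[OF assms]] by (simp_all add: LCat_def)

lemma LCat_Comp [simp]:
  assumes "lwf C t" "lwf C s" "ldom C t = lcod C s"
  shows "lclass C t \<cdot>\<^bsub>LCat C\<^esub> lclass C s = lclass C (LComp t s)"
  unfolding LCat_def cat.simps
  by (rule lclass_eqI[symmetric], rule lrel.Comp_cong) (use assms lrel_representative in auto)

lemma LCat_TensA [simp]:
  assumes "lwf C t" "lwf C s"
  shows "lclass C t \<odot>\<^bsub>LCat C\<^esub> lclass C s = lclass C (LTens t s)"
  unfolding LCat_def moncat.simps
  by (rule lclass_eqI[symmetric], rule lrel.Tens_cong) (use assms lrel_representative in auto)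

lemma LCat_HomE:
  assumes "T \<in> Hom (LCat C) xs ys"
  obtains t where "T = lclass C t" "lwf C t" "ldom C t = xs" "lcod C t = ys"
  using assms by (auto simp: Hom_def)

lemma LCat_HomI:
  "lwf C t \<Longrightarrow> xs = ldom C t \<Longrightarrow> ys = lcod C t \<Longrightarrow> lclass C t \<in> Hom (LCat C) xs ys"
  by (auto simp: Hom_def)

text \<open>Once arrows are written as classes of well-formed terms, each equational axiom is the
  rule of \<open>lrel\<close> imposing it, and each typing axiom is a computation with
  \<open>ldom\<close> and \<open>lcod\<close>.\<close>

lemma strict_monoidal_category_LCat: "strict_monoidal_category (LCat C)"
proof
  fix T assume "T \<in> Arr (LCat C)"
  then obtain t where t: "T = lclass C t" "lwf C t" by auto
  then show "Dom (LCat C) T \<in> Obj (LCat C)" "Cod (LCat C) T \<in> Obj (LCat C)"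
    using ldom_lcod_Obj by simp_all
  show "Ident (LCat C) (Unit (LCat C)) \<odot>\<^bsub>LCat C\<^esub> T = T"
    "T \<odot>\<^bsub>LCat C\<^esub> Ident (LCat C) (Unit (LCat C)) = T"
    using t lclass_eqI[OF lrel.Tens_Unit_left] lclass_eqI[OF lrel.Tens_Unit_right] by simp_all
next
  fix xs assume "xs \<in> Obj (LCat C)"
  then show "Ident (LCat C) xs \<in> Hom (LCat C) xs xs" by (auto intro: LCat_HomI)
next
  fix T S xs ys zs assume "T \<in> Hom (LCat C) xs ys" "S \<in> Hom (LCat C) ys zs"
  then show "S \<cdot>\<^bsub>LCat C\<^esub> T \<in> Hom (LCat C) xs zs" by (auto elim!: LCat_HomE intro!: LCat_HomI)
next
  fix T xs ys assume "T \<in> Hom (LCat C) xs ys"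
  then obtain t where "T = lclass C t" "lwf C t" "ldom C t = xs" "lcod C t = ys"
    by (rule LCat_HomE)
  then show "Ident (LCat C) ys \<cdot>\<^bsub>LCat C\<^esub> T = T" "T \<cdot>\<^bsub>LCat C\<^esub> Ident (LCat C) xs = T"
    using lclass_eqI[OF lrel.Id_left] lclass_eqI[OF lrel.Id_right] ldom_lcod_Obj by auto
next
  fix T S R xs ys zs ws
  assume "T \<in> Hom (LCat C) xs ys" "S \<in> Hom (LCat C) ys zs" "R \<in> Hom (LCat C) zs ws"
  then show "(R \<cdot>\<^bsub>LCat C\<^esub> S) \<cdot>\<^bsub>LCat C\<^esub> T = R \<cdot>\<^bsub>LCat C\<^esub> (S \<cdot>\<^bsub>LCat C\<^esub> T)"
    using lclass_eqI[OF lrel.Comp_assoc] by (elim LCat_HomE) simp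
next
  fix T S xs ys xs' ys' assume "T \<in> Hom (LCat C) xs ys" "S \<in> Hom (LCat C) xs' ys'"
  then show "T \<odot>\<^bsub>LCat C\<^esub> S \<in> Hom (LCat C) (xs \<otimes>\<^bsub>LCat C\<^esub> xs') (ys \<otimes>\<^bsub>LCat C\<^esub> ys')"
    by (auto elim!: LCat_HomE intro!: LCat_HomI)
next
  fix xs ys assume "xs \<in> Obj (LCat C)" "ys \<in> Obj (LCat C)"
  then show "Ident (LCat C) xs \<odot>\<^bsub>LCat C\<^esub> Ident (LCat C) ys = Ident (LCat C) (xs \<otimes>\<^bsub>LCat C\<^esub> ys)"
    using lclass_eqI[OF lrel.Tens_Id] by simp
next
  fix T S T' S' xs ys zs xs' ys' zs'
  assume "T \<in> Hom (LCat C) xs ys" "S \<in> Hom (LCat C) ys zs"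
    "T' \<in> Hom (LCat C) xs' ys'" "S' \<in> Hom (LCat C) ys' zs'"
  then show "(S \<cdot>\<^bsub>LCat C\<^esub> T) \<odot>\<^bsub>LCat C\<^esub> (S' \<cdot>\<^bsub>LCat C\<^esub> T')
      = (S \<odot>\<^bsub>LCat C\<^esub> S') \<cdot>\<^bsub>LCat C\<^esub> (T \<odot>\<^bsub>LCat C\<^esub> T')"
    using lclass_eqI[OF lrel.Tens_Comp] by (elim LCat_HomE) simp
next
  fix T S R assume "T \<in> Arr (LCat C)" "S \<in> Arr (LCat C)" "R \<in> Arr (LCat C)"
  then obtain t s r where "T = lclass C t" "S = lclass C s" "R = lclass C r"
    "lwf C t" "lwf C s" "lwf C r"
    by auto
  then show "(T \<odot>\<^bsub>LCat C\<^esub> S) \<odot>\<^bsub>LCat C\<^esub> R = T \<odot>\<^bsub>LCat C\<^esub> (S \<odot>\<^bsub>LCat C\<^esub> R)"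
    using lclass_eqI[OF lrel.Tens_assoc] by simp
qed auto

end

section \<open>The functor categories\<close>

context lax_monoidal_functor
begin

lemma onO_Obj [simp]: "x \<in> Obj C \<Longrightarrow> onO F x \<in> Obj D"
  by (rule FO_Obj)

lemma mult_typing [simp]:
  assumes "x \<in> Obj C" "y \<in> Obj C"
  shows "mult F x y \<in> Arr D" "Dom D (mult F x y) = onO F x \<otimes>\<^bsub>D\<^esub> onO F y"
    "Cod D (mult F x y) = onO F (x \<otimes>\<^bsub>C\<^esub> y)"
  using mult_Hom[OF assms] by (auto simp: Hom_def)

lemma unit_typing [simp]:
  "unit F \<in> Arr D" "Dom D (unit F) = \<one>\<^bsub>D\<^esub>" "Cod D (unit F) = onO F \<one>\<^bsub>C\<^esub>"
  using unit_Hom by (auto simp: Hom_def)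

end

context strict_monoidal_functor
begin

lemma onO_TensO [simp]:
  assumes "x \<in> Obj C" "y \<in> Obj C"
  shows "onO F (x \<otimes>\<^bsub>C\<^esub> y) = onO F x \<otimes>\<^bsub>D\<^esub> onO F y"
  using mult_typing(3)[OF assms] mult_Ident[OF assms] assms by simp

lemma onO_Unit [simp]: "onO F \<one>\<^bsub>C\<^esub> = \<one>\<^bsub>D\<^esub>"
  using unit_typing(3) unit_Ident by simp

text \<open>This is naturality of \<open>mult\<close>, where both occurrences of \<open>mult\<close>
  are identities.\<close>

lemma onA_TensA:
  assumes "f \<in> Arr C" "g \<in> Arr C"
  shows "onA F (f \<odot>\<^bsub>C\<^esub> g) = onA F f \<odot>\<^bsub>D\<^esub> onA F g"
  using mult_natural[of f "Dom C f" "Cod C f" g "Dom C g" "Cod C g"] assms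
  by (simp add: Hom_def mult_Ident)

end

context monoidal_transformation
begin

lemma cmp_typing [simp]:
  assumes "x \<in> Obj C"
  shows "cmp \<sigma> x \<in> Arr D" "Dom D (cmp \<sigma> x) = onO (Src \<sigma>) x" "Cod D (cmp \<sigma> x) = onO (Tgt \<sigma>) x"
  using cmp_Hom[OF assms] by (auto simp: Hom_def)

end

lemma (in lax_monoidal_functor) monoidal_transformation_Ident:
  "monoidal_transformation C D \<lparr>Src = F, Tgt = F, cmp = (\<lambda>x \<in> Obj C. Ident D (onO F x))\<rparr>"
  by (intro monoidal_transformation.intro monoidal_transformation_axioms.intro)
    (auto simp: lax_monoidal_functor_axioms Hom_def D.TensA_Ident)

text \<open>Each condition on the composite is obtained by pasting the diagrams of \<sigma> and
  \<tau> along the functor \<open>Tgt \<sigma> = Src \<tau>\<close>.\<close>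

lemma monoidal_transformation_Comp:
  assumes "monoidal_transformation C D \<sigma>" "monoidal_transformation C D \<tau>" "Tgt \<sigma> = Src \<tau>"
  shows "monoidal_transformation C D
    \<lparr>Src = Src \<sigma>, Tgt = Tgt \<tau>, cmp = (\<lambda>x \<in> Obj C. cmp \<tau> x \<cdot>\<^bsub>D\<^esub> cmp \<sigma> x)\<rparr>"
proof -
  interpret S: monoidal_transformation C D \<sigma> by fact
  interpret T: monoidal_transformation C D \<tau> by fact
  note eq = assms(3)
  let ?c = "\<lambda>x. cmp \<tau> x \<cdot>\<^bsub>D\<^esub> cmp \<sigma> x"
  have natural: "?c (Cod C f) \<cdot>\<^bsub>D\<^esub> onA (Src \<sigma>) f = onA (Tgt \<tau>) f \<cdot>\<^bsub>D\<^esub> ?c (Dom C f)"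
    if f: "f \<in> Arr C" for f
  proof -
    have fH: "f \<in> Hom C (Dom C f) (Cod C f)" using f by (simp add: Hom_def)
    have "?c (Cod C f) \<cdot>\<^bsub>D\<^esub> onA (Src \<sigma>) f
        = cmp \<tau> (Cod C f) \<cdot>\<^bsub>D\<^esub> (cmp \<sigma> (Cod C f) \<cdot>\<^bsub>D\<^esub> onA (Src \<sigma>) f)"
      using f by (simp add: S.Src.D.Comp_assoc_Arr eq)
    also have "\<dots> = (cmp \<tau> (Cod C f) \<cdot>\<^bsub>D\<^esub> onA (Src \<tau>) f) \<cdot>\<^bsub>D\<^esub> cmp \<sigma> (Dom C f)"
      using f by (simp add: S.Src.D.Comp_assoc_Arr S.cmp_natural[OF fH] eq)
    also have "\<dots> = onA (Tgt \<tau>) f \<cdot>\<^bsub>D\<^esub> ?c (Dom C f)"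
      using f by (simp add: S.Src.D.Comp_assoc_Arr T.cmp_natural[OF fH] eq)
    finally show ?thesis .
  qed
  have mult: "?c (x \<otimes>\<^bsub>C\<^esub> y) \<cdot>\<^bsub>D\<^esub> mult (Src \<sigma>) x y = mult (Tgt \<tau>) x y \<cdot>\<^bsub>D\<^esub> (?c x \<odot>\<^bsub>D\<^esub> ?c y)"
    if xy: "x \<in> Obj C" "y \<in> Obj C" for x y
  proof -
    have "?c (x \<otimes>\<^bsub>C\<^esub> y) \<cdot>\<^bsub>D\<^esub> mult (Src \<sigma>) x y
        = cmp \<tau> (x \<otimes>\<^bsub>C\<^esub> y) \<cdot>\<^bsub>D\<^esub> (cmp \<sigma> (x \<otimes>\<^bsub>C\<^esub> y) \<cdot>\<^bsub>D\<^esub> mult (Src \<sigma>) x y)"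
      using xy by (simp add: S.Src.D.Comp_assoc_Arr eq)
    also have "\<dots> = (cmp \<tau> (x \<otimes>\<^bsub>C\<^esub> y) \<cdot>\<^bsub>D\<^esub> mult (Src \<tau>) x y) \<cdot>\<^bsub>D\<^esub> (cmp \<sigma> x \<odot>\<^bsub>D\<^esub> cmp \<sigma> y)"
      using xy by (simp add: S.Src.D.Comp_assoc_Arr S.cmp_mult[OF xy] eq)
    \<comment> \<open>The interchange law splits the tensor of the two composites into the tensored
      components of \<tau> after those of \<sigma>.\<close>
    also have "\<dots> = mult (Tgt \<tau>) x y \<cdot>\<^bsub>D\<^esub> (?c x \<odot>\<^bsub>D\<^esub> ?c y)"
      using xy by (simp add: S.Src.D.Comp_assoc_Arr S.Src.D.TensA_Comp_Arr T.cmp_mult[OF xy] eq)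
    finally show ?thesis .
  qed
  have unit: "?c \<one>\<^bsub>C\<^esub> \<cdot>\<^bsub>D\<^esub> unit (Src \<sigma>) = unit (Tgt \<tau>)"
    using S.cmp_unit T.cmp_unit by (simp add: S.Src.D.Comp_assoc_Arr eq)
  show ?thesis
    by (intro monoidal_transformation.intro monoidal_transformation_axioms.intro)
      (use natural mult unit in \<open>auto simp: Hom_def eq S.Src.lax_monoidal_functor_axioms
        T.Tgt.lax_monoidal_functor_axioms\<close>)
qed

lemma Lax_simps [simp]:
  "Obj (Lax C D) = {F. lax_monoidal_functor C D F}"
  "Arr (Lax C D) = {\<sigma>. monoidal_transformation C D \<sigma>}"
  "Dom (Lax C D) = Src" "Cod (Lax C D) = Tgt"
  "Ident (Lax C D) F = \<lparr>Src = F, Tgt = F, cmp = (\<lambda>x \<in> Obj C. Ident D (onO F x))\<rparr>"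
  "\<tau> \<cdot>\<^bsub>Lax C D\<^esub> \<sigma> = \<lparr>Src = Src \<sigma>, Tgt = Tgt \<tau>, cmp = (\<lambda>x \<in> Obj C. cmp \<tau> x \<cdot>\<^bsub>D\<^esub> cmp \<sigma> x)\<rparr>"
  by (simp_all add: Lax_def)

lemma Strict_simps [simp]:
  "Obj (Strict C D) = {F. strict_monoidal_functor C D F}"
  "Arr (Strict C D) = {\<sigma>. monoidal_transformation C D \<sigma> \<and>
     strict_monoidal_functor C D (Src \<sigma>) \<and> strict_monoidal_functor C D (Tgt \<sigma>)}"
  "Dom (Strict C D) = Src" "Cod (Strict C D) = Tgt"
  "Ident (Strict C D) F = \<lparr>Src = F, Tgt = F, cmp = (\<lambda>x \<in> Obj C. Ident D (onO F x))\<rparr>"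
  "\<tau> \<cdot>\<^bsub>Strict C D\<^esub> \<sigma> = \<lparr>Src = Src \<sigma>, Tgt = Tgt \<tau>, cmp = (\<lambda>x \<in> Obj C. cmp \<tau> x \<cdot>\<^bsub>D\<^esub> cmp \<sigma> x)\<rparr>"
  by (simp_all add: Strict_def Lax_def)

lemma montrans_eqI:
  fixes \<sigma> \<tau> :: "('o, 'a, 'p, 'b) montrans"
  assumes "Src \<sigma> = Src \<tau>" "Tgt \<sigma> = Tgt \<tau>" "cmp \<sigma> \<in> extensional X" "cmp \<tau> \<in> extensional X"
    and "\<And>x. x \<in> X \<Longrightarrow> cmp \<sigma> x = cmp \<tau> x"
  shows "\<sigma> = \<tau>"
  using assms by (intro montrans.equality extensionalityI[of _ X]) auto

text \<open>Category laws hold componentwise in \<open>D\<close>, whose axioms come with membership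
  in \<open>Obj\<close> or \<open>Arr\<close>. Equality of transformations, and not just of
  components on \<open>Obj C\<close>, relies on \<open>cmp_undefined\<close>.\<close>

lemma category_Lax: "category (Lax C D)"
proof
  fix \<sigma> assume "\<sigma> \<in> Arr (Lax C D)"
  then interpret S: monoidal_transformation C D \<sigma> by simp
  show "Dom (Lax C D) \<sigma> \<in> Obj (Lax C D)" "Cod (Lax C D) \<sigma> \<in> Obj (Lax C D)"
    by (simp_all add: S.Src.lax_monoidal_functor_axioms S.Tgt.lax_monoidal_functor_axioms)
next
  fix F assume "F \<in> Obj (Lax C D)"
  then show "Ident (Lax C D) F \<in> Hom (Lax C D) F F"
    by (simp add: Hom_def lax_monoidal_functor.monoidal_transformation_Ident)
next
  fix \<sigma> \<tau> F G H assume "\<sigma> \<in> Hom (Lax C D) F G" "\<tau> \<in> Hom (Lax C D) G H"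
  then show "\<tau> \<cdot>\<^bsub>Lax C D\<^esub> \<sigma> \<in> Hom (Lax C D) F H"
    using monoidal_transformation_Comp[of C D \<sigma> \<tau>] by (auto simp: Hom_def)
next
  fix \<sigma> F G assume \<sigma>: "\<sigma> \<in> Hom (Lax C D) F G"
  then interpret S: monoidal_transformation C D \<sigma> by (simp add: Hom_def)
  show "Ident (Lax C D) G \<cdot>\<^bsub>Lax C D\<^esub> \<sigma> = \<sigma>" "\<sigma> \<cdot>\<^bsub>Lax C D\<^esub> Ident (Lax C D) F = \<sigma>"
    using \<sigma> by (auto simp: Hom_def S.cmp_undefined intro!: montrans_eqI[of _ _ "Obj C"])
next
  fix \<sigma> \<tau> \<upsilon> F G H K
  assume *: "\<sigma> \<in> Hom (Lax C D) F G" "\<tau> \<in> Hom (Lax C D) G H" "\<upsilon> \<in> Hom (Lax C D) H K"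
  interpret S: monoidal_transformation C D \<sigma> using * by (simp add: Hom_def)
  interpret T: monoidal_transformation C D \<tau> using * by (simp add: Hom_def)
  interpret U: monoidal_transformation C D \<upsilon> using * by (simp add: Hom_def)
  show "(\<upsilon> \<cdot>\<^bsub>Lax C D\<^esub> \<tau>) \<cdot>\<^bsub>Lax C D\<^esub> \<sigma> = \<upsilon> \<cdot>\<^bsub>Lax C D\<^esub> (\<tau> \<cdot>\<^bsub>Lax C D\<^esub> \<sigma>)"
    using * by (auto simp: Hom_def S.Src.D.Comp_assoc_Arr intro!: montrans_eqI[of _ _ "Obj C"])
qed

text \<open>\<open>Strict\<close> is the full subcategory of \<open>Lax\<close> on the strict
  functors: its condition on arrows concerns only source and target.\<close>

lemma category_Strict: "category (Strict C D)"
proof -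
  have "Strict C D = (Lax C D)\<lparr>Obj := {F. strict_monoidal_functor C D F},
    Arr := {\<sigma> \<in> Arr (Lax C D). Dom (Lax C D) \<sigma> \<in> {F. strict_monoidal_functor C D F}
      \<and> Cod (Lax C D) \<sigma> \<in> {F. strict_monoidal_functor C D F}}\<rparr>"
    by (simp add: Strict_def)
  then show ?thesis
    using category.full_subcategory[OF category_Lax, of "{F. strict_monoidal_functor C D F}" C D]
    by (auto simp: strict_monoidal_functor_def)
qed

section \<open>Extending a lax monoidal functor to \<open>L(C)\<close>\<close>

text \<open>The interpretation of formal expressions in \<open>D\<close>, given on raw terms; its
  passage to classes is \<open>leval_lrel\<close>.\<close>

primrec leval :: "('p, 'b, 'n) moncat_scheme \<Rightarrow> ('o, 'a, 'p, 'b) laxfun \<Rightarrow> ('o, 'a) lterm \<Rightarrow> 'b" where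
  "leval D F (Gen f) = onA F f"
| "leval D F (Ell x z) = mult F x z"
| "leval D F Jay = unit F"
| "leval D F (LId xs) = Ident D (tensOs D (map (onO F) xs))"
| "leval D F (LComp t s) = leval D F t \<cdot>\<^bsub>D\<^esub> leval D F s"
| "leval D F (LTens t s) = leval D F t \<odot>\<^bsub>D\<^esub> leval D F s"

text \<open>The structure maps are identities so that the result is strict. The undefined values off
  the carriers are those demanded by the locale, which lets the inverse laws hold as equalities of
  records.\<close>

definition extend :: "('o, 'a, 'm) moncat_scheme \<Rightarrow> ('p, 'b, 'n) moncat_scheme
    \<Rightarrow> ('o, 'a, 'p, 'b) laxfun \<Rightarrow> ('o list, ('o, 'a) lterm set, 'p, 'b) laxfun" where
  "extend C D F = \<lparr>
     onO = (\<lambda>xs \<in> lists (Obj C). tensOs D (map (onO F) xs)),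
     onA = (\<lambda>T \<in> Arr (LCat C). leval D F (SOME t. t \<in> T)),
     mult = (\<lambda>xs ys. if xs \<in> lists (Obj C) \<and> ys \<in> lists (Obj C)
       then Ident D (tensOs D (map (onO F) (xs @ ys))) else undefined),
     unit = Ident D (Unit D)\<rparr>"

definition extend_trans :: "('o, 'a, 'm) moncat_scheme \<Rightarrow> ('p, 'b, 'n) moncat_scheme
    \<Rightarrow> ('o, 'a, 'p, 'b) montrans \<Rightarrow> ('o list, ('o, 'a) lterm set, 'p, 'b) montrans" where
  "extend_trans C D \<sigma> = \<lparr>
     Src = extend C D (Src \<sigma>),
     Tgt = extend C D (Tgt \<sigma>),
     cmp = (\<lambda>xs \<in> lists (Obj C). tensAs D (map (cmp \<sigma>) xs))\<rparr>"

context lax_monoidal_functor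
begin

lemma tensOs_onO_Obj [simp]: "xs \<in> lists (Obj C) \<Longrightarrow> tensOs D (map (onO F) xs) \<in> Obj D"
  by (rule D.tensOs_Obj) (auto simp: in_lists_conv_set)

lemma tensOs_onO_append [simp]:
  assumes "xs \<in> lists (Obj C)" "ys \<in> lists (Obj C)"
  shows "tensOs D (map (onO F) xs @ map (onO F) ys)
    = tensOs D (map (onO F) xs) \<otimes>\<^bsub>D\<^esub> tensOs D (map (onO F) ys)"
  using assms by (intro D.tensOs_append) (auto simp: in_lists_conv_set)

lemma leval_typing [simp]:
  assumes "lwf C t"
  shows "leval D F t \<in> Arr D" "Dom D (leval D F t) = tensOs D (map (onO F) (ldom C t))"
    "Cod D (leval D F t) = tensOs D (map (onO F) (lcod C t))"
proof -
  have "leval D F t \<in> Arr D \<and> Dom D (leval D F t) = tensOs D (map (onO F) (ldom C t)) \<and>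
      Cod D (leval D F t) = tensOs D (map (onO F) (lcod C t))"
    using assms
  proof (induction t)
    case (LTens t s)
    then show ?case
      using C.ldom_lcod_Obj[of t] C.ldom_lcod_Obj[of s]
      by simp
  qed auto
  then show "leval D F t \<in> Arr D" "Dom D (leval D F t) = tensOs D (map (onO F) (ldom C t))"
    "Cod D (leval D F t) = tensOs D (map (onO F) (lcod C t))"
    by auto
qed

text \<open>Soundness of the presentation: the monoidal rules hold by the axioms of
  \<open>D\<close>, the defining relations by the axioms of a lax monoidal functor for
  \<open>F\<close>.\<close>

lemma leval_lrel: "lrel C t s \<Longrightarrow> leval D F t = leval D F s"
proof (induction rule: lrel.induct)
  case (Comp_assoc t s r)
  then show ?case by (simp add: D.Comp_assoc_Arr)
next
  case (Tens_Id xs ys)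
  then show ?case by (simp add: D.TensA_Ident)
next
  case (Tens_Comp t s t' s')
  then show ?case by (simp add: D.TensA_Comp_Arr)
next
  case (Tens_assoc t s r)
  then show ?case by (simp add: D.TensA_assoc)
next
  case (Gen_Ident x)
  then show ?case by (simp add: FA_Ident)
next
  case (Gen_Comp f x y g z)
  then show ?case by (simp add: FA_Comp)
next
  case (Ell_natural f x y f' x' y')
  then show ?case by (simp add: mult_natural)
next
  \<comment> \<open>\<open>LId [w]\<close> evaluates to the identity of \<open>onO F w\<close>
    tensored with the unit; simp drops that unit, leaving \<open>mult_assoc\<close>.\<close>
  case (Ell_assoc x z w)
  then show ?case by (simp add: mult_assoc)
next
  case (Ell_Unit_right x)
  then show ?case by (simp add: mult_unit_right)
next
  case (Ell_Unit_left x)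
  then show ?case by (simp add: mult_unit_left)
qed auto

lemma extend_simps [simp]:
  "xs \<in> lists (Obj C) \<Longrightarrow> onO (extend C D F) xs = tensOs D (map (onO F) xs)"
  "lwf C t \<Longrightarrow> onA (extend C D F) (lclass C t) = leval D F t"
  "xs \<in> lists (Obj C) \<Longrightarrow> ys \<in> lists (Obj C) \<Longrightarrow>
    mult (extend C D F) xs ys = Ident D (tensOs D (map (onO F) xs) \<otimes>\<^bsub>D\<^esub> tensOs D (map (onO F) ys))"
  "unit (extend C D F) = Ident D (Unit D)"
  using leval_lrel[OF C.lrel_representative, of t]
  by (simp_all add: extend_def)

text \<open>Functoriality and compatibility with tensor products are the clauses of
  \<open>leval\<close>, read on representatives.\<close>

lemma strict_monoidal_functor_extend: "strict_monoidal_functor (LCat C) D (extend C D F)"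
proof -
  interpret L: strict_monoidal_category "LCat C" by (rule C.strict_monoidal_category_LCat)
  have wf: "ldom C t \<in> lists (Obj C)" "lcod C t \<in> lists (Obj C)" if "lwf C t" for t
    using that C.ldom_lcod_Obj by auto
  show ?thesis
    apply unfold_locales
    subgoal by simp
    subgoal using wf by (auto elim!: C.LCat_HomE simp: D.Hom_iff)
    subgoal by simp
    subgoal by (auto elim!: C.LCat_HomE)
    subgoal by (simp add: D.Hom_iff)
    \<comment> \<open>Naturality of the identity multiplications: \<open>leval\<close> takes
      \<open>LTens\<close> to the tensor product in \<open>D\<close>.\<close>
    subgoal using wf by (auto elim!: C.LCat_HomE)
    subgoal by (simp add: D.Hom_iff)
    subgoal by (simp add: D.TensA_Ident D.TensO_assoc)
    subgoal by (simp add: D.TensA_Ident)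
    subgoal by (simp add: D.TensA_Ident)
    subgoal by (auto simp: extend_def)
    subgoal by (auto simp: extend_def)
    subgoal by (auto simp: extend_def)
    subgoal by simp
    subgoal by simp
    done
qed

end

section \<open>Extending monoidal transformations\<close>

lemma (in monoidal_transformation) map_cmp_typing:
  assumes "xs \<in> lists (Obj C)"
  shows "cmp \<sigma> ` set xs \<subseteq> Arr D" "map (Dom D \<circ> cmp \<sigma>) xs = map (onO (Src \<sigma>)) xs"
    "map (Cod D \<circ> cmp \<sigma>) xs = map (onO (Tgt \<sigma>)) xs"
  using assms by (auto simp: in_lists_conv_set)

lemma (in monoidal_transformation) leval_natural:
  assumes "lwf C t"
  shows "tensAs D (map (cmp \<sigma>) (lcod C t)) \<cdot>\<^bsub>D\<^esub> leval D (Src \<sigma>) t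
    = leval D (Tgt \<sigma>) t \<cdot>\<^bsub>D\<^esub> tensAs D (map (cmp \<sigma>) (ldom C t))"
  using assms
proof (induction t)
  case (Gen f)
  then show ?case using cmp_natural[of f "Dom C f" "Cod C f"] by (simp add: Hom_def)
next
  case (Ell x z)
  then show ?case by (simp add: cmp_mult)
next
  case Jay
  then show ?case by (simp add: cmp_unit)
next
  case (LId xs)
  then show ?case by (simp add: map_cmp_typing)
next
  case (LComp t s)
  have wf: "ldom C t \<in> lists (Obj C)" "lcod C t \<in> lists (Obj C)"
    "ldom C s \<in> lists (Obj C)" "lcod C s \<in> lists (Obj C)"
    using LComp.prems Src.C.ldom_lcod_Obj by auto
  let ?T = "\<lambda>xs. tensAs D (map (cmp \<sigma>) xs)"
  have "?T (lcod C t) \<cdot>\<^bsub>D\<^esub> (leval D (Src \<sigma>) t \<cdot>\<^bsub>D\<^esub> leval D (Src \<sigma>) s)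
      = (?T (lcod C t) \<cdot>\<^bsub>D\<^esub> leval D (Src \<sigma>) t) \<cdot>\<^bsub>D\<^esub> leval D (Src \<sigma>) s"
    using LComp.prems wf by (simp add: map_cmp_typing Src.D.Comp_assoc_Arr)
  \<comment> \<open>The induction hypothesis for \<open>t\<close> produces
    \<open>?T (ldom C t)\<close>, and \<open>ldom C t = lcod C s\<close> since the composite is well
    formed.\<close>
  also have "\<dots> = leval D (Tgt \<sigma>) t \<cdot>\<^bsub>D\<^esub> (?T (lcod C s) \<cdot>\<^bsub>D\<^esub> leval D (Src \<sigma>) s)"
    using LComp wf by (simp add: map_cmp_typing Src.D.Comp_assoc_Arr)
  also have "\<dots> = (leval D (Tgt \<sigma>) t \<cdot>\<^bsub>D\<^esub> leval D (Tgt \<sigma>) s) \<cdot>\<^bsub>D\<^esub> ?T (ldom C s)"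
    using LComp wf by (simp add: map_cmp_typing Src.D.Comp_assoc_Arr)
  finally show ?case by simp
next
  case (LTens t s)
  have wf: "ldom C t \<in> lists (Obj C)" "lcod C t \<in> lists (Obj C)"
    "ldom C s \<in> lists (Obj C)" "lcod C s \<in> lists (Obj C)"
    using LTens.prems Src.C.ldom_lcod_Obj by auto
  \<comment> \<open>Interchange, read from right to left, turns each side into a tensor product of
    one side of the square for \<open>t\<close> and one side of the square for
    \<open>s\<close>.\<close>
  then show ?case
    using LTens by (simp add: map_cmp_typing Src.D.tensAs_append flip: Src.D.TensA_Comp_Arr)
qed

lemma (in monoidal_transformation) monoidal_transformation_extend:
  "monoidal_transformation (LCat C) D (extend_trans C D \<sigma>)"
proof -
  interpret S: strict_monoidal_functor "LCat C" D "extend C D (Src \<sigma>)"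
    by (rule Src.strict_monoidal_functor_extend)
  interpret T: strict_monoidal_functor "LCat C" D "extend C D (Tgt \<sigma>)"
    by (rule Tgt.strict_monoidal_functor_extend)
  have wf: "ldom C t \<in> lists (Obj C)" "lcod C t \<in> lists (Obj C)" if "lwf C t" for t
    using that Src.C.ldom_lcod_Obj by auto
  show ?thesis
    apply (intro monoidal_transformation.intro monoidal_transformation_axioms.intro)
    subgoal by (simp add: extend_trans_def S.lax_monoidal_functor_axioms)
    subgoal by (simp add: extend_trans_def T.lax_monoidal_functor_axioms)
    subgoal by (simp add: extend_trans_def Src.D.Hom_iff map_cmp_typing)
    subgoal by (elim Src.C.LCat_HomE) (use wf in \<open>auto simp: extend_trans_def leval_natural\<close>)
    \<comment> \<open>Compatibility with the identity multiplications reduces to multiplicativity of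
      \<open>tensAs\<close> under concatenation.\<close>
    subgoal by (simp add: extend_trans_def map_cmp_typing Src.D.tensAs_append)
    subgoal by (simp add: extend_trans_def)
    subgoal by (simp add: extend_trans_def)
    done
qed

section \<open>Restricting a strict monoidal functor along the generators\<close>

text \<open>Precomposition of \<open>G\<close> with the universal lax monoidal functor from
  \<open>C\<close> to \<open>LCat C\<close>, whose structure maps are the classes of
  \<open>Ell\<close> and \<open>Jay\<close>.\<close>

definition restr :: "('o, 'a, 'm) moncat_scheme
    \<Rightarrow> ('o list, ('o, 'a) lterm set, 'p, 'b) laxfun \<Rightarrow> ('o, 'a, 'p, 'b) laxfun" where
  "restr C G = \<lparr>
     onO = (\<lambda>x \<in> Obj C. onO G [x]),
     onA = (\<lambda>f \<in> Arr C. onA G (lclass C (Gen f))),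
     mult = (\<lambda>x y. if x \<in> Obj C \<and> y \<in> Obj C then onA G (lclass C (Ell x y)) else undefined),
     unit = onA G (lclass C Jay)\<rparr>"

definition restr_trans :: "('o, 'a, 'm) moncat_scheme
    \<Rightarrow> ('o list, ('o, 'a) lterm set, 'p, 'b) montrans \<Rightarrow> ('o, 'a, 'p, 'b) montrans" where
  "restr_trans C \<tau> = \<lparr>
     Src = restr C (Src \<tau>),
     Tgt = restr C (Tgt \<tau>),
     cmp = (\<lambda>x \<in> Obj C. cmp \<tau> [x])\<rparr>"

lemma restr_simps [simp]:
  "x \<in> Obj C \<Longrightarrow> onO (restr C G) x = onO G [x]"
  "f \<in> Arr C \<Longrightarrow> onA (restr C G) f = onA G (lclass C (Gen f))"
  "x \<in> Obj C \<Longrightarrow> y \<in> Obj C \<Longrightarrow> mult (restr C G) x y = onA G (lclass C (Ell x y))"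
  "unit (restr C G) = onA G (lclass C Jay)"
  by (simp_all add: restr_def)

text \<open>\<open>Base\<close> supplies the axioms for \<open>C\<close> itself, which the
  computation with classes of terms over \<open>C\<close> uses through
  \<open>lrel_typing\<close>.\<close>

locale strict_functor_on_LCat =
  Base: strict_monoidal_category C + strict_monoidal_functor "LCat C" D G
  for C :: "('o, 'a, 'm) moncat_scheme" and D :: "('p, 'b, 'n) moncat_scheme"
    and G :: "('o list, ('o, 'a) lterm set, 'p, 'b) laxfun"
begin

text \<open>A strict functor preserves concatenation and the empty list, so it is determined on
  objects by its values on single symbols.\<close>

lemma onO_list:
  "xs \<in> lists (Obj C) \<Longrightarrow> tensOs D (map (\<lambda>x. onO G [x]) xs) = onO G xs"
proof (induction xs)
  case Nil
  then show ?case using onO_Unit by simp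
next
  case (Cons x xs)
  then show ?case using onO_TensO[of "[x]" xs] by simp
qed

lemma onO_restr_list:
  "xs \<in> lists (Obj C) \<Longrightarrow> tensOs D (map (onO (restr C G)) xs) = onO G xs"
  by (subst onO_list[symmetric]) (auto simp: in_lists_conv_set intro!: arg_cong[of _ _ "tensOs D"])

lemma onA_lclass:
  assumes "lwf C t"
  shows "onA G (lclass C t) \<in> Arr D" "Dom D (onA G (lclass C t)) = onO G (ldom C t)"
    "Cod D (onA G (lclass C t)) = onO G (lcod C t)"
  using assms FA_typing[of "lclass C t"] by simp_all

lemma onA_LComp:
  assumes "lwf C (LComp t s)"
  shows "onA G (lclass C (LComp t s)) = onA G (lclass C t) \<cdot>\<^bsub>D\<^esub> onA G (lclass C s)"
  using assms FA_Comp_Arr[of "lclass C s" "lclass C t"] by simp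

lemma onA_LTens:
  assumes "lwf C t" "lwf C s"
  shows "onA G (lclass C (LTens t s)) = onA G (lclass C t) \<odot>\<^bsub>D\<^esub> onA G (lclass C s)"
  using assms onA_TensA[of "lclass C t" "lclass C s"] by simp

lemma onA_LId: "xs \<in> lists (Obj C) \<Longrightarrow> onA G (lclass C (LId xs)) = Ident D (onO G xs)"
  using FA_Ident[of xs] by simp

text \<open>The uniqueness half of the universal property: a strict functor respects every term
  constructor and is therefore determined by its values on the generators.\<close>

lemma leval_restr:
  assumes "lwf C t"
  shows "leval D (restr C G) t = onA G (lclass C t)"
  using assms by (induction t) (auto simp: onA_LComp onA_LTens onA_LId onO_restr_list)

text \<open>Here \<open>restr C G\<close> is not yet known to be lax, so \<open>leval_lrel\<close>
  cannot be applied; instead both sides are values of \<open>G\<close> on one class. Applied to the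
  defining relations, this gives the equational axioms of a lax monoidal functor.\<close>

lemma leval_restr_lrel:
  assumes "lrel C t s"
  shows "leval D (restr C G) t = leval D (restr C G) s"
  using Base.lrel_typing'[OF assms] Base.lclass_eqI[OF assms] by (simp add: leval_restr)

lemma lax_monoidal_functor_restr: "lax_monoidal_functor C D (restr C G)"
proof -
  have O: "onO G [x] \<in> Obj D" if "x \<in> Obj C" for x
    using that FO_Obj[of "[x]"] by simp
  \<comment> \<open>Gives the image of \<open>Ell x y\<close> the domain required of
    \<open>mult\<close>.\<close>
  have O2: "onO G [x, y] = onO G [x] \<otimes>\<^bsub>D\<^esub> onO G [y]" if "x \<in> Obj C" "y \<in> Obj C" for x y
    using that onO_list[of "[x, y]"] O by simp
  have H: "f \<in> Arr C" "Dom C f = x" "Cod C f = y" "x \<in> Obj C" "y \<in> Obj C"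
    if "f \<in> Hom C x y" for f x y
    using that by (auto simp: Hom_def)
  show ?thesis
    apply unfold_locales
    subgoal using O by simp
    subgoal using O by (auto simp: Hom_def onA_lclass)
    subgoal for x using O leval_restr_lrel[OF lrel.Gen_Ident, of x] by simp
    subgoal for f x y g z using leval_restr_lrel[OF lrel.Gen_Comp, of f x y g z]
      by (auto simp: Hom_def)
    subgoal by (simp add: D.Hom_iff onA_lclass O2)
    subgoal for f x y f' x' y' using leval_restr_lrel[OF lrel.Ell_natural, of f x y f' x' y']
      by (auto simp: Hom_def)
    subgoal using onO_Unit by (simp add: D.Hom_iff onA_lclass)
    subgoal for x y z using leval_restr_lrel[OF lrel.Ell_assoc, of x y z] O by simp
    subgoal for x using leval_restr_lrel[OF lrel.Ell_Unit_left, of x] O by simp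
    subgoal for x using leval_restr_lrel[OF lrel.Ell_Unit_right, of x] O by simp
    subgoal by (simp add: restr_def)
    subgoal by (simp add: restr_def)
    subgoal by (auto simp: restr_def)
    done
qed

lemma extend_restr: "extend C D (restr C G) = G"
proof -
  interpret R: lax_monoidal_functor C D "restr C G" by (rule lax_monoidal_functor_restr)
  show ?thesis
  proof (rule laxfun.equality)
    show "onO (extend C D (restr C G)) = onO G"
      by (rule extensionalityI[of _ "lists (Obj C)"])
        (use onO_undefined in \<open>auto simp: onO_restr_list in_listsI extend_def\<close>)
    show "onA (extend C D (restr C G)) = onA G"
    proof (rule extensionalityI[of _ "Arr (LCat C)"])
      show "onA (extend C D (restr C G)) \<in> extensional (Arr (LCat C))"
        by (simp add: extend_def)
      show "onA (extend C D (restr C G)) T = onA G T" if "T \<in> Arr (LCat C)" for T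
        using that by (auto simp: leval_restr)
    qed (rule onA_undefined)
    show "mult (extend C D (restr C G)) = mult G"
    proof (intro ext)
      fix xs ys
      show "mult (extend C D (restr C G)) xs ys = mult G xs ys"
      proof (cases "xs \<in> lists (Obj C) \<and> ys \<in> lists (Obj C)")
        case True
        then show ?thesis using mult_Ident[of xs ys] by (simp add: onO_restr_list)
      next
        case False
        then show ?thesis using mult_undefined[of xs ys] by (auto simp: extend_def)
      qed
    qed
    show "unit (extend C D (restr C G)) = unit G"
      using unit_Ident by simp
  qed simp
qed

end

text \<open>On generators \<open>leval\<close> returns the data of \<open>F\<close>, and a
  one-symbol list returns the object up to a strict unit; off the carriers both sides are
  undefined.\<close>

lemma (in lax_monoidal_functor) restr_extend: "restr C (extend C D F) = F"
proof (rule laxfun.equality)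
  show "onO (restr C (extend C D F)) = onO F"
    by (rule extensionalityI[of _ "Obj C"]) (use onO_undefined in \<open>auto simp: restr_def\<close>)
  show "onA (restr C (extend C D F)) = onA F"
    by (rule extensionalityI[of _ "Arr C"]) (use onA_undefined in \<open>auto simp: restr_def\<close>)
  show "mult (restr C (extend C D F)) = mult F"
    using mult_undefined by (intro ext) (simp add: restr_def)
qed simp_all

section \<open>Restricting monoidal transformations\<close>

locale transformation_on_LCat =
  monoidal_transformation "LCat C" D \<tau> +
  S: strict_functor_on_LCat C D "Src \<tau>" + T: strict_functor_on_LCat C D "Tgt \<tau>"
  for C :: "('o, 'a, 'm) moncat_scheme" and D :: "('p, 'b, 'n) moncat_scheme"
    and \<tau> :: "('o list, ('o, 'a) lterm set, 'p, 'b) montrans"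
begin

text \<open>Both units are identities, so \<open>cmp_unit\<close> fixes the component at the empty
  list.\<close>

lemma cmp_Nil: "cmp \<tau> [] = Ident D \<one>\<^bsub>D\<^esub>"
  using cmp_unit S.unit_Ident T.unit_Ident S.onO_Unit T.onO_Unit cmp_typing[of "[]"] by simp

lemma cmp_append:
  assumes "xs \<in> lists (Obj C)" "ys \<in> lists (Obj C)"
  shows "cmp \<tau> (xs @ ys) = cmp \<tau> xs \<odot>\<^bsub>D\<^esub> cmp \<tau> ys"
  using assms cmp_mult[of xs ys] cmp_typing[of "xs @ ys"] cmp_typing[of xs] cmp_typing[of ys]
    S.onO_TensO[of xs ys] T.onO_TensO[of xs ys] S.mult_Ident[of xs ys] T.mult_Ident[of xs ys]
  by simp

text \<open>The components at single symbols determine \<tau>, by \<open>cmp_Nil\<close> and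
  \<open>cmp_append\<close>.\<close>

lemma tensAs_cmp:
  "xs \<in> lists (Obj C) \<Longrightarrow> tensAs D (map (\<lambda>x. cmp \<tau> [x]) xs) = cmp \<tau> xs"
proof (induction xs)
  case Nil
  then show ?case by (simp add: cmp_Nil)
next
  case (Cons x xs)
  then show ?case using cmp_append[of "[x]" xs] by simp
qed

lemma cmp_lclass:
  assumes "lwf C t"
  shows "cmp \<tau> (lcod C t) \<cdot>\<^bsub>D\<^esub> onA (Src \<tau>) (lclass C t)
    = onA (Tgt \<tau>) (lclass C t) \<cdot>\<^bsub>D\<^esub> cmp \<tau> (ldom C t)"
  using assms by (intro cmp_natural S.Base.LCat_HomI) auto

lemma monoidal_transformation_restr: "monoidal_transformation C D (restr_trans C \<tau>)"
proof -
  interpret SR: lax_monoidal_functor C D "restr C (Src \<tau>)"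
    by (rule S.lax_monoidal_functor_restr)
  interpret TR: lax_monoidal_functor C D "restr C (Tgt \<tau>)"
    by (rule T.lax_monoidal_functor_restr)
  show ?thesis
    apply (intro monoidal_transformation.intro monoidal_transformation_axioms.intro)
    subgoal by (simp add: restr_trans_def SR.lax_monoidal_functor_axioms)
    subgoal by (simp add: restr_trans_def TR.lax_monoidal_functor_axioms)
    subgoal by (simp add: restr_trans_def Src.D.Hom_iff)
    subgoal for f x y using cmp_lclass[of "Gen f"] by (auto simp: restr_trans_def Hom_def)
    \<comment> \<open>\<open>cmp_mult\<close> is naturality of \<tau> at the generator
      \<open>Ell x y\<close>, with its component at \<open>[x, y]\<close> split into a tensor
      product.\<close>
    subgoal for x y using cmp_lclass[of "Ell x y"] cmp_append[of "[x]" "[y]"]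
      by (simp add: restr_trans_def)
    \<comment> \<open>\<open>cmp_unit\<close> is naturality at \<open>Jay\<close>, whose source is
      the empty list, where the component is an identity.\<close>
    subgoal using cmp_lclass[of Jay] T.onA_lclass[of Jay] T.onO_Unit
      by (simp add: restr_trans_def cmp_Nil)
    subgoal by (simp add: restr_trans_def)
    done
qed

lemma extend_restr_trans: "extend_trans C D (restr_trans C \<tau>) = \<tau>"
proof (rule montrans_eqI[of _ _ "lists (Obj C)"])
  fix xs assume xs: "xs \<in> lists (Obj C)"
  then have "map (cmp (restr_trans C \<tau>)) xs = map (\<lambda>x. cmp \<tau> [x]) xs"
    by (auto simp: restr_trans_def in_lists_conv_set)
  then show "cmp (extend_trans C D (restr_trans C \<tau>)) xs = cmp \<tau> xs"
    \<comment> \<open>\<open>map_eq_conv\<close> would break the equation of lists into pointwise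
      equations, and it could no longer rewrite the argument of \<open>tensAs\<close>.\<close>
    using xs by (simp add: extend_trans_def tensAs_cmp del: map_eq_conv)
qed (use cmp_undefined in \<open>simp_all add: extend_trans_def restr_trans_def S.extend_restr T.extend_restr\<close>)

end

lemma (in monoidal_transformation) restr_extend_trans:
  "restr_trans C (extend_trans C D \<sigma>) = \<sigma>"
  by (rule montrans_eqI[of _ _ "Obj C"])
    (simp_all add: restr_trans_def extend_trans_def cmp_undefined Src.restr_extend Tgt.restr_extend)

section \<open>The isomorphism\<close>

lemma cat_functor_extend:
  "cat_functor (Lax C D) (Strict (LCat C) D) (extend C D) (extend_trans C D)"
proof (intro cat_functor.intro category_Lax category_Strict cat_functor_axioms.intro)
  fix F assume "F \<in> Obj (Lax C D)"
  then interpret lax_monoidal_functor C D F by simp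
  show "extend C D F \<in> Obj (Strict (LCat C) D)"
    by (simp add: strict_monoidal_functor_extend)
  \<comment> \<open>The identity transformation has identity components only on
    \<open>Obj C\<close>, so the comparison with \<open>tensAs_Ident\<close> goes entry by
    entry.\<close>
  have "tensAs D (map (cmp (Ident (Lax C D) F)) xs) = Ident D (tensOs D (map (onO F) xs))"
    if "xs \<in> lists (Obj C)" for xs
  proof -
    have "set (map (onO F) xs) \<subseteq> Obj D" using that by auto
    from D.tensAs_Ident[OF this] show ?thesis
      using that by (auto simp: comp_def in_lists_conv_set cong: map_cong)
  qed
  then show "extend_trans C D (Ident (Lax C D) F) = Ident (Strict (LCat C) D) (extend C D F)"
    by (intro montrans_eqI[of _ _ "lists (Obj C)"]) (simp_all add: extend_trans_def)
next
  fix \<sigma> F G assume \<sigma>: "\<sigma> \<in> Hom (Lax C D) F G"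
  then interpret monoidal_transformation C D \<sigma> by (simp add: Hom_def)
  show "extend_trans C D \<sigma> \<in> Hom (Strict (LCat C) D) (extend C D F) (extend C D G)"
    using \<sigma> monoidal_transformation_extend Src.strict_monoidal_functor_extend
      Tgt.strict_monoidal_functor_extend
    by (auto simp: Hom_def extend_trans_def)
next
  fix \<sigma> \<tau> F G H assume *: "\<sigma> \<in> Hom (Lax C D) F G" "\<tau> \<in> Hom (Lax C D) G H"
  interpret S: monoidal_transformation C D \<sigma> using * by (simp add: Hom_def)
  interpret T: monoidal_transformation C D \<tau> using * by (simp add: Hom_def)
  have "tensAs D (map (cmp (\<tau> \<cdot>\<^bsub>Lax C D\<^esub> \<sigma>)) xs)
      = tensAs D (map (cmp \<tau>) xs) \<cdot>\<^bsub>D\<^esub> tensAs D (map (cmp \<sigma>) xs)"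
    if "xs \<in> lists (Obj C)" for xs
    using that * S.Src.D.tensAs_Comp[of xs "cmp \<sigma>" "cmp \<tau>"]
    by (auto simp: in_lists_conv_set Hom_def cong: map_cong)
  then show "extend_trans C D (\<tau> \<cdot>\<^bsub>Lax C D\<^esub> \<sigma>)
      = extend_trans C D \<tau> \<cdot>\<^bsub>Strict (LCat C) D\<^esub> extend_trans C D \<sigma>"
    by (intro montrans_eqI[of _ _ "lists (Obj C)"]) (simp_all add: extend_trans_def)
qed

text \<open>Restriction reads off the components at one-symbol lists, and identities and composites
  of transformations are formed componentwise.\<close>

lemma cat_functor_restr:
  assumes "strict_monoidal_category C"
  shows "cat_functor (Strict (LCat C) D) (Lax C D) (restr C) (restr_trans C)"
proof (intro cat_functor.intro category_Lax category_Strict cat_functor_axioms.intro)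
  fix F assume "F \<in> Obj (Strict (LCat C) D)"
  then interpret strict_functor_on_LCat C D F
    using assms by (simp add: strict_functor_on_LCat_def)
  show "restr C F \<in> Obj (Lax C D)"
    by (simp add: lax_monoidal_functor_restr)
  show "restr_trans C (Ident (Strict (LCat C) D) F) = Ident (Lax C D) (restr C F)"
    by (intro montrans_eqI[of _ _ "Obj C"]) (simp_all add: restr_trans_def)
next
  fix \<tau> F G assume *: "\<tau> \<in> Hom (Strict (LCat C) D) F G"
  then interpret transformation_on_LCat C D \<tau>
    using assms by (auto simp: Hom_def transformation_on_LCat_def strict_functor_on_LCat_def)
  show "restr_trans C \<tau> \<in> Hom (Lax C D) (restr C F) (restr C G)"
    using * monoidal_transformation_restr by (auto simp: Hom_def restr_trans_def)
next
  fix \<sigma> \<tau> F G H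
  show "restr_trans C (\<tau> \<cdot>\<^bsub>Strict (LCat C) D\<^esub> \<sigma>)
      = restr_trans C \<tau> \<cdot>\<^bsub>Lax C D\<^esub> restr_trans C \<sigma>"
    by (intro montrans_eqI[of _ _ "Obj C"]) (simp_all add: restr_trans_def)
qed

theorem proposition2p2:
  fixes C :: "('o, 'a) moncat" and D :: "('p, 'b) moncat"
  assumes "strict_monoidal_category C" and "strict_monoidal_category D"
  shows "isomorphic_cats (Lax C D) (Strict (LCat C) D)"
  unfolding isomorphic_cats_def
proof (intro exI conjI ballI)
  show "cat_functor (Lax C D) (Strict (LCat C) D) (extend C D) (extend_trans C D)"
    by (rule cat_functor_extend)
  show "cat_functor (Strict (LCat C) D) (Lax C D) (restr C) (restr_trans C)"
    using assms(1) by (rule cat_functor_restr)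
next
  fix F assume "F \<in> Obj (Lax C D)"
  then show "restr C (extend C D F) = F" by (simp add: lax_monoidal_functor.restr_extend)
next
  fix \<sigma> assume "\<sigma> \<in> Arr (Lax C D)"
  then show "restr_trans C (extend_trans C D \<sigma>) = \<sigma>"
    by (simp add: monoidal_transformation.restr_extend_trans)
next
  fix G assume "G \<in> Obj (Strict (LCat C) D)"
  then show "extend C D (restr C G) = G"
    using assms(1) by (simp add: strict_functor_on_LCat.extend_restr strict_functor_on_LCat_def)
next
  fix \<tau> assume "\<tau> \<in> Arr (Strict (LCat C) D)"
  then show "extend_trans C D (restr_trans C \<tau>) = \<tau>"
    using assms(1) by (simp add: transformation_on_LCat.extend_restr_trans
      transformation_on_LCat_def strict_functor_on_LCat_def)
qed

end
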